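(* Let $q$ be a prime power and $n$ a positive integer, and identify $\mathbb{F}_q^n$ with the field $\mathbb{F}_{q^n}$, regarded as a vector space over $\mathbb{F}_q$. Let $W$ be a multiset over $\mathbb{F}_q^n$. Then $W$ is a multispace over $\mathbb{F}_q^n$ if and only if, for some $\ell\mid n$, $W$ is the multiset of all roots (counted with multiplicity) of a nonzero linearized polynomial over the subfield $\mathbb{F}_{q^\ell}$ of $\mathbb{F}_{q^n}$.
   Context: A multiset $M$ over a universe $U$ is given by a multiplicity function $\mu_M\colon U\to\{0,1,2,\ldots\}$. For a finite multiset $B=\{\!\{b_1,\ldots,b_m\}\!\}$ over $\mathbb{F}_q^n$ (the $b_i$ are not necessarily distinct), the multispan $\operatorname{mspan}_q(B)$ is the multiset over $\mathbb{F}_q^n$ in which the multiplicity of $v$ is the number of $m$-tuples $(\alpha_1,\ldots,\alpha_m)\in\mathbb{F}_q^m$ with $\sum_{i=1}^m\alpha_i b_i=v$; if $B$ is empty, $\operatorname{mspan}_q(B)=\{0\}$ (with $0$ of multiplicity $1$). A multiset $W$ over $\mathbb{F}_q^n$ is a multispace over $\mathbb{F}_q^n$ if $W=\operatorname{mspan}_q(B)$ for some multiset $B$. A linearized polynomial (or $q$-polynomial) over $\mathbb{F}_{q^\ell}$ is a polynomial of the form $L(x)=\sum_{i=0}^d\alpha_i x^{q^i}$ with $\alpha_i\in\mathbb{F}_{q^\ell}$. The identification of $\mathbb{F}_q^n$ with $\mathbb{F}_{q^n}$ is via a fixed $\mathbb{F}_q$-linear isomorphism. "All roots" means all roots in an algebraic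 closure of $\mathbb{F}_{q^n}$; in particular, saying that $W$ is the multiset of all roots of $L$ entails that all the roots of $L$ lie in $\mathbb{F}_{q^n}$. *)

theory Defs
  imports
    "HOL-Analysis.Finite_Cartesian_Product"
    "HOL-Combinatorics.List_Permutation"
    "HOL-Algebra.Algebraic_Closure_Type"
begin

text \<open>
  The multispan of an enumerated finite multiset \<open>b\<^sub>0, \<dots>, b\<^sub>m\<^sub>-\<^sub>1\<close>: one element
  \<open>\<Sum> \<alpha>\<^sub>i b\<^sub>i\<close> for every coefficient tuple \<open>\<alpha>\<close>, encoded as a list of length \<open>m\<close>.
  The multiplicity form is lemma \<open>count_mspan\<close> below.
\<close>

definition mspan_list :: "('k::{field,finite} ^ 'n) list \<Rightarrow> ('k ^ 'n) multiset" where
  "mspan_list bs =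
     image_mset (\<lambda>\<alpha>. \<Sum>i<length bs. (\<alpha> ! i) *s (bs ! i))
       (mset_set {\<alpha> :: 'k list. length \<alpha> = length bs})"

text \<open>The enumeration chosen here is irrelevant, by \<open>mspan_mset\<close>.\<close>

definition mspan :: "('k::{field,finite} ^ 'n) multiset \<Rightarrow> ('k ^ 'n) multiset" where
  "mspan B = mspan_list (SOME bs. mset bs = B)"

definition multispace :: "('k::{field,finite} ^ 'n) multiset \<Rightarrow> bool" where
  "multispace W \<longleftrightarrow> (\<exists>B. W = mspan B)"

definition linearized_poly :: "nat \<Rightarrow> 'a::field set \<Rightarrow> 'a poly \<Rightarrow> bool" where
  "linearized_poly q K L \<longleftrightarrow>
     (\<exists>d \<alpha>. (\<forall>i\<le>d. \<alpha> i \<in> K) \<and> L = (\<Sum>i\<le>d. Polynomial.monom (\<alpha> i) (q ^ i)))"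

text \<open>
  Roots are taken with multiplicity in the algebraic closure, so \<open>all_roots L M\<close>
  forces every root of \<open>L\<close> to lie in the ground field.  Only meaningful for
  \<open>L \<noteq> 0\<close>, since \<open>proots 0 = {#}\<close>.
\<close>

definition all_roots :: "'a::field poly \<Rightarrow> 'a multiset \<Rightarrow> bool" where
  "all_roots L M \<longleftrightarrow> proots (map_poly to_ac L) = image_mset to_ac M"

lemma finite_lists_length_eq_UNIV: "finite {\<alpha> :: 'k::finite list. length \<alpha> = m}"
  using finite_lists_length_eq[of "UNIV :: 'k set" m] by simp

lemma count_mspan_list:
  fixes bs :: "('k::{field,finite} ^ 'n) list"
  shows "count (mspan_list bs) v =
    card {\<alpha>. length \<alpha> = length bs \<and> (\<Sum>i<length bs. (\<alpha> ! i) *s (bs ! i)) = v}"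
proof -
  let ?A = "{\<alpha> :: 'k list. length \<alpha> = length bs}"
  let ?f = "\<lambda>\<alpha>. \<Sum>i<length bs. (\<alpha> ! i) *s (bs ! i)"
  have "count (mspan_list bs) v = card {\<alpha> \<in> ?A. ?f \<alpha> = v}"
    unfolding mspan_list_def count_image_mset
    using finite_lists_length_eq_UNIV[where ?'k = 'k and m = "length bs"]
    by (auto simp: sum.If_cases vimage_def Int_def intro!: arg_cong[where f = card])
  then show ?thesis by simp
qed

lemma mspan_list_cong:
  fixes bs cs :: "('k::{field,finite} ^ 'n) list"
  assumes "mset bs = mset cs"
  shows "mspan_list bs = mspan_list cs"
proof (rule multiset_eqI)
  fix v
  obtain p where p: "p permutes {..<length cs}" "permute_list p cs = bs"
    using mset_eq_permutation[OF assms] by blast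
  have len: "length bs = length cs" using assms by (metis size_mset)
  let ?S = "\<lambda>bs :: ('k ^ 'n) list. {\<alpha> :: 'k list. length \<alpha> = length bs \<and>
    (\<Sum>i<length bs. (\<alpha> ! i) *s (bs ! i)) = v}"
  have sum_eq: "(\<Sum>i<length cs. (permute_list p \<alpha> ! i) *s (bs ! i)) =
      (\<Sum>i<length cs. (\<alpha> ! i) *s (cs ! i))" if "length \<alpha> = length cs" for \<alpha> :: "'k list"
  proof -
    have "(\<Sum>i<length cs. (permute_list p \<alpha> ! i) *s (bs ! i)) =
        (\<Sum>i<length cs. (\<alpha> ! p i) *s (cs ! p i))"
      using p that by (intro sum.cong) (auto simp: permute_list_nth)
    also have "\<dots> = (\<Sum>i<length cs. (\<alpha> ! i) *s (cs ! i))"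
      using sum.permute[OF p(1), of "\<lambda>i. (\<alpha> ! i) *s (cs ! i)"] by (simp add: o_def)
    finally show ?thesis .
  qed
  have inv1: "permute_list p (permute_list (inv_into UNIV p) \<alpha>) = \<alpha>"
    and inv2: "permute_list (inv_into UNIV p) (permute_list p \<alpha>) = \<alpha>"
    if "length \<alpha> = length cs" for \<alpha> :: "'k list"
    using that p(1) permutes_inv[OF p(1)] permute_list_compose[of "inv_into UNIV p" \<alpha> p]
      permute_list_compose[of p \<alpha> "inv_into UNIV p"]
    by (auto simp: permutes_inv_o[OF p(1)] permute_list_compose[symmetric])
  have "bij_betw (permute_list p) (?S cs) (?S bs)"
  proof (rule bij_betw_byWitness[where f' = "permute_list (inv_into UNIV p)"])
    show "permute_list p ` ?S cs \<subseteq> ?S bs"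
      using len sum_eq by auto
    show "permute_list (inv_into UNIV p) ` ?S bs \<subseteq> ?S cs"
    proof
      fix \<beta> assume "\<beta> \<in> permute_list (inv_into UNIV p) ` ?S bs"
      then obtain \<alpha> where \<alpha>: "\<alpha> \<in> ?S bs" "\<beta> = permute_list (inv_into UNIV p) \<alpha>" by blast
      then show "\<beta> \<in> ?S cs"
        using len inv1[of \<alpha>] sum_eq[of \<beta>] by auto
    qed
  qed (use len inv1 inv2 in auto)
  then show "count (mspan_list bs) v = count (mspan_list cs) v"
    unfolding count_mspan_list by (metis (no_types, lifting) bij_betw_same_card)
qed

lemma mspan_mset: "mspan (mset bs) = mspan_list bs"
  unfolding mspan_def by (rule mspan_list_cong) (rule someI, rule refl)

lemma count_mspan:
  fixes bs :: "('k::{field,finite} ^ 'n) list"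
  shows "count (mspan (mset bs)) v =
    card {\<alpha>. length \<alpha> = length bs \<and> (\<Sum>i<length bs. (\<alpha> ! i) *s (bs ! i)) = v}"
  by (simp add: mspan_mset count_mspan_list)

lemma mspan_empty: "mspan {#} = {#0#}"
  using mspan_mset[of "[]"] by (simp add: mspan_list_def)

end

(* If L is linearized, so is L^q - L(b)^(q-1) L, which is the product of the translates
   L(X - c b) over c in F_q.  Starting from X and processing a generating list one vector b at a
   time therefore shows that the polynomial whose root multiset is the multispan is linearized;
   neither independence nor distinctness of the generators plays any role.

   Conversely, a linearized L satisfies L(X - v) = L(X) for each of its roots v, so all roots have
   the multiplicity q^e of the root 0.  The roots form a subspace, which is the multispan of a
   basis, and e additional zero vectors produce the multiplicity q^e.  This part is applied
   directly to the image of L over the algebraic closure, so no transfer of multiplicities is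
   needed. *)

theory Submission
  imports Defs "HOL-Analysis.Cartesian_Space"
begin

section \<open>Powers in finite fields; composition and order of polynomials\<close>

lemma power_card_eq_self:
  fixes c :: "'k::{field,finite}"
  shows "c ^ CARD('k) = c"
proof (cases "c = 0")
  case False
  \<comment> \<open>Multiplication by a nonzero \<open>c\<close> permutes the nonzero elements, and
    their product can then be cancelled.\<close>
  have "(\<Prod>y\<in>UNIV - {0}. y) = (\<Prod>y\<in>UNIV - {0}. c * y)"
    by (rule prod.reindex_bij_witness[of _ "\<lambda>y. c * y" "\<lambda>y. y / c"]) (use False in auto)
  also have "\<dots> = c ^ (CARD('k) - 1) * (\<Prod>y\<in>UNIV - {0}. y)"
    by (simp add: prod.distrib card_Diff_singleton)
  finally have "c ^ (CARD('k) - 1) = 1"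
    by simp
  then have "c ^ Suc (CARD('k) - 1) = c"
    by (simp only: power_Suc mult_1_right)
  then show ?thesis
    by (simp add: card_gt_0_iff)
qed (simp add: card_gt_0_iff)

text \<open>Only the two extreme binomial terms survive. \<open>binomial_card_eq_0\<close> will
  supply the hypothesis on the others.\<close>

lemma binomial_power_add:
  fixes x y :: "'a::comm_semiring_1"
  assumes "\<And>k. 0 < k \<Longrightarrow> k < q \<Longrightarrow> of_nat (q choose k) = (0::'a)" and "q > 0"
  shows "(x + y) ^ q = x ^ q + y ^ q"
proof -
  have "(x + y) ^ q = (\<Sum>k\<le>q. of_nat (q choose k) * x ^ k * y ^ (q - k))"
    by (rule binomial_ring)
  also have "\<dots> = (\<Sum>k\<in>{0, q}. of_nat (q choose k) * x ^ k * y ^ (q - k))"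
    by (rule sum.mono_neutral_right) (use assms(1) in auto)
  also have "\<dots> = x ^ q + y ^ q"
    using assms(2) by (simp add: add.commute)
  finally show ?thesis .
qed

lemma pcompose_power: "(p ^ n) \<circ>\<^sub>p r = (p \<circ>\<^sub>p r) ^ n"
  for p r :: "'a::comm_semiring_1 poly"
  by (induction n) (simp_all add: pcompose_mult pcompose_1)

lemma pcompose_monom: "Polynomial.monom a n \<circ>\<^sub>p r = smult a (r ^ n)"
  for r :: "'a::comm_semiring_1 poly"
  by (simp add: monom_altdef pcompose_smult pcompose_power pcompose_pCons)

text \<open>After the full power of X is split off, the cofactor composed with
  \<open>[:- v, 1:]\<close> takes at \<open>v\<close> its former value at 0, which is nonzero.
  Together with translation invariance this makes all roots of a linearized polynomial equally
  multiple.\<close>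

lemma order_shift:
  fixes p :: "'a::field poly"
  assumes "p \<noteq> 0"
  shows "Polynomial.order v (p \<circ>\<^sub>p [:- v, 1:]) = Polynomial.order 0 p"
proof -
  define m where "m = Polynomial.order 0 p"
  obtain r where r: "p = [:- 0, 1:] ^ m * r" "\<not> [:- 0, 1:] dvd r"
    using order_decomp[OF assms] unfolding m_def by blast
  have "p \<circ>\<^sub>p [:- v, 1:] = [:- v, 1:] ^ m * (r \<circ>\<^sub>p [:- v, 1:])"
    unfolding r(1) pcompose_mult pcompose_power by (simp add: pcompose_pCons)
  moreover have "poly (r \<circ>\<^sub>p [:- v, 1:]) v \<noteq> 0"
    using r(2) by (simp add: poly_pcompose dvd_iff_poly_eq_0)
  moreover from this have "r \<circ>\<^sub>p [:- v, 1:] \<noteq> 0"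
    by auto
  ultimately show ?thesis
    by (simp add: order_mult order_power_n_n order_0I flip: m_def)
qed

section \<open>Polynomials with a prescribed root multiset\<close>

definition root_poly :: "'a::field multiset \<Rightarrow> 'a poly" where
  "root_poly M = (\<Prod>v\<in>#M. [:- v, 1:])"

lemma root_poly_simps [simp]:
  "root_poly {#} = 1" "root_poly (add_mset v M) = [:- v, 1:] * root_poly M"
  "root_poly (M + N) = root_poly M * root_poly N"
  by (simp_all add: root_poly_def)

lemma root_poly_nonzero [simp]: "root_poly M \<noteq> 0"
  by (induction M) (simp_all del: mult_pCons_left)

lemma proots_root_poly [simp]: "proots (root_poly M) = M"
  by (induction M) (simp_all add: proots_mult del: mult_pCons_left)

lemma root_poly_sum: "root_poly (\<Sum>i\<in>I. M i) = (\<Prod>i\<in>I. root_poly (M i))"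
  by (induction I rule: infinite_finite_induct) simp_all

lemma root_poly_translate:
  "root_poly (image_mset ((+) t) M) = root_poly M \<circ>\<^sub>p [:- t, 1:]"
  by (induction M) (simp_all add: pcompose_1 pcompose_mult pcompose_pCons del: mult_pCons_left)

lemma map_poly_to_ac_root_poly:
  "map_poly to_ac (root_poly M) = root_poly (image_mset to_ac M)"
proof (induction M)
  case (add v M)
  have "map_poly to_ac ([:- v, 1:] * p) = [:- to_ac v, 1:] * map_poly to_ac p" for p
    by (rule poly_eqI) (simp add: coeff_map_poly coeff_pCons split: nat.split)
  with add show ?case by (simp del: mult_pCons_left)
qed simp

text \<open>The factorization into linear factors persists over the closure, so no root arises
  outside the ground field.\<close>

lemma all_roots_root_poly: "all_roots (root_poly M) M"
  by (simp add: all_roots_def map_poly_to_ac_root_poly)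

section \<open>Multispans generated one vector at a time\<close>

lemma mspan_list_Nil [simp]: "mspan_list [] = {#0#}"
  by (simp add: mspan_list_def)

text \<open>Coefficient tuples are grouped by their head \<open>c\<close>. The multiset sum records
  overlaps of the translates, so \<open>b\<close> may depend on \<open>bs\<close> or even be
  zero.\<close>

lemma mspan_list_Cons:
  fixes b :: "'k::{field,finite} ^ 'n"
  shows "mspan_list (b # bs) = (\<Sum>c\<in>UNIV. image_mset ((+) (c *s b)) (mspan_list bs))"
proof -
  let ?A = "\<lambda>m. {\<alpha> :: 'k list. length \<alpha> = m}"
  have "mset_set (?A (Suc m)) = (\<Sum>c\<in>UNIV. image_mset ((#) c) (mset_set (?A m)))" for m
  proof (rule multiset_eqI)
    fix \<alpha> :: "'k list"
    have "count (image_mset ((#) c) (mset_set (?A m))) \<alpha> =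
        (if \<alpha> \<noteq> [] \<and> hd \<alpha> = c \<and> length \<alpha> = Suc m then 1 else 0)" for c
    proof -
      have "image_mset ((#) c) (mset_set (?A m)) = mset_set ((#) c ` ?A m)"
        by (rule image_mset_mset_set) simp
      then show ?thesis
        using finite_lists_length_eq_UNIV[where 'k='k and m=m]
        by (cases \<alpha>) (auto simp: count_mset_set')
    qed
    then show "count (mset_set (?A (Suc m))) \<alpha> =
        count (\<Sum>c\<in>UNIV. image_mset ((#) c) (mset_set (?A m))) \<alpha>"
      using finite_lists_length_eq_UNIV[where 'k='k and m="Suc m"]
      by (cases \<alpha>) (simp_all add: count_sum count_mset_set')
  qed
  moreover have "image_mset f (sum g S) = (\<Sum>c\<in>S. image_mset f (g c))"
    for f :: "'k list \<Rightarrow> 'k ^ 'n" and g :: "'k \<Rightarrow> 'k list multiset" and S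
    by (induction S rule: infinite_finite_induct) simp_all
  ultimately show ?thesis
    by (simp add: mspan_list_def multiset.map_comp o_def sum.lessThan_Suc_shift
        del: sum.lessThan_Suc)
qed

lemma count_mspan_list_Cons:
  "count (mspan_list (b # bs)) v = (\<Sum>c\<in>UNIV. count (mspan_list bs) (v - c *s b))"
proof -
  have "count (image_mset ((+) t) M) v = count M (v - t)" for t :: "'a ^ 'b" and M
    by (induction M) (auto simp: diff_eq_eq add.commute)
  then show ?thesis
    by (simp add: mspan_list_Cons count_sum)
qed

text \<open>All \<open>CARD('k)\<close> translates along a zero vector coincide. This is how the
  converse direction produces multiplicities above 1.\<close>

lemma count_mspan_list_append_zeros:
  fixes bs :: "('k::{field,finite} ^ 'n) list"
  shows "count (mspan_list (replicate e 0 @ bs)) v = CARD('k) ^ e * count (mspan_list bs) v"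
  by (induction e) (simp_all add: count_mspan_list_Cons)

text \<open>Adjoining \<open>b\<close> outside the span keeps all multiplicities at 1: each
  \<open>v\<close> in the larger span has exactly one \<open>c\<close> with
  \<open>v - c *s b\<close> in the smaller one.\<close>

lemma mspan_list_independent:
  fixes B :: "('k::{field,finite} ^ 'n) set"
  assumes "finite B" "vec.independent B"
  shows "\<exists>bs. mspan_list bs = mset_set (vec.span B)"
  using assms
proof (induction B)
  case empty
  have "mspan_list [] = mset_set (vec.span {})"
    by simp
  then show ?case by blast
next
  case (insert b B)
  then obtain bs where bs: "mspan_list bs = mset_set (vec.span B)" and b: "b \<notin> vec.span B"
    by (auto simp: vec.independent_insert)
  have "mspan_list (b # bs) = mset_set (vec.span (insert b B))"
  proof (rule multiset_eqI)
    fix v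
    \<comment> \<open>Two admissible coefficients would put a nonzero multiple of \<open>b\<close>,
      hence \<open>b\<close> itself, into the old span.\<close>
    have unique: "c = c'" if "v - c *s b \<in> vec.span B" "v - c' *s b \<in> vec.span B" for c c'
    proof (rule ccontr)
      assume "c \<noteq> c'"
      have "(c' - c) *s b \<in> vec.span B"
        using vec.span_diff[OF that] by (simp add: vec.scale_left_diff_distrib)
      with \<open>c \<noteq> c'\<close> b show False
        using vec.span_scale[of "(c' - c) *s b" B "inverse (c' - c)"] by simp
    qed
    have *: "count (mspan_list (b # bs)) v = (\<Sum>c\<in>UNIV. of_bool (v - c *s b \<in> vec.span B))"
      by (simp add: count_mspan_list_Cons bs count_mset_set' of_bool_def)
    show "count (mspan_list (b # bs)) v = count (mset_set (vec.span (insert b B))) v"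
    proof (cases "v \<in> vec.span (insert b B)")
      case True
      then obtain c where c: "v - c *s b \<in> vec.span B"
        by (auto simp: vec.span_insert)
      then have "v - c' *s b \<in> vec.span B \<longleftrightarrow> c' = c" for c'
        using unique by blast
      with True * show ?thesis
        by (simp add: count_mset_set' of_bool_def)
    next
      case False
      then show ?thesis
        unfolding * by (simp add: vec.span_insert)
    qed
  qed
  then show ?case by blast
qed

lemma multispace_subspace:
  fixes W :: "('k::{field,finite} ^ 'n) multiset"
  assumes "vec.subspace V" and "\<And>v. count W v = (if v \<in> V then CARD('k) ^ e else 0)"
  shows "multispace W"
proof -
  obtain B where B: "B \<subseteq> V" "vec.independent B" "V \<subseteq> vec.span B"
    by (rule vec.maximal_independent_subset)
  then have V: "vec.span B = V"
    using assms(1) by (simp add: vec.span_minimal subset_antisym)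
  obtain bs where "mspan_list bs = mset_set V"
    using mspan_list_independent[OF _ B(2)] V by auto
  then have "mspan_list (replicate e 0 @ bs) = W"
    by (intro multiset_eqI) (simp add: count_mspan_list_append_zeros assms(2) count_mset_set')
  then show ?thesis
    unfolding multispace_def by (metis mspan_mset)
qed

section \<open>Frobenius powers over a field containing a copy of the base field\<close>

locale finite_field_embedding =
  fixes q :: nat and \<iota> :: "'k::{field,finite} \<Rightarrow> 'l::field"
  assumes card_base: "CARD('k) = q"
    and hom_add: "\<iota> (x + y) = \<iota> x + \<iota> y"
    and hom_mult: "\<iota> (x * y) = \<iota> x * \<iota> y"
    and hom_one: "\<iota> 1 = 1"
begin

lemma q_gt_1: "q > 1"
proof -
  have "card {0, 1 :: 'k} \<le> CARD('k)"
    by (rule card_mono) simp_all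
  then show ?thesis by (simp add: card_base)
qed

lemma q_gt_0 [simp]: "q > 0"
  using q_gt_1 by simp

lemma hom_diff: "\<iota> (x - y) = \<iota> x - \<iota> y"
  using hom_add[of "x - y" y] by (simp add: eq_diff_eq)

lemma hom_power: "\<iota> (x ^ m) = \<iota> x ^ m"
  by (induction m) (simp_all add: hom_one hom_mult)

lemma hom_eq_iff: "\<iota> x = \<iota> y \<longleftrightarrow> x = y"
proof
  assume "\<iota> x = \<iota> y"
  then have "\<iota> (x - y) = 0"
    by (simp add: hom_diff)
  then have "\<iota> ((x - y) * inverse (x - y)) = 0"
    by (simp add: hom_mult)
  then show "x = y"
    using hom_one by (cases "x = y") auto
qed simp

lemma hom_power_card: "\<iota> c ^ (q ^ i) = \<iota> c"
proof (induction i)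
  case (Suc i)
  have "\<iota> c ^ (q ^ Suc i) = (\<iota> c ^ q) ^ (q ^ i)"
    by (simp add: power_mult)
  then show ?case
    using Suc by (simp add: power_card_eq_self flip: hom_power card_base)
qed simp

text \<open>For nonzero \<open>s\<close> both sides are monic of degree \<open>q\<close> and vanish
  at the \<open>q\<close> distinct points \<open>\<iota> c * s\<close>; for \<open>s = 0\<close>
  both are the \<open>q\<close>-th power of X.\<close>

lemma prod_linear_factors:
  "(\<Prod>c\<in>UNIV. [:- (\<iota> c * s), 1:]) =
     Polynomial.monom 1 q - smult (s ^ (q - 1)) (Polynomial.monom 1 1)"
proof (cases "s = 0")
  case True
  have "q - 1 > 0"
    using q_gt_1 by simp
  with True show ?thesis
    by (simp add: monom_altdef power_0_left card_base)
next
  case False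
  let ?P = "\<Prod>c\<in>UNIV. [:- (\<iota> c * s), 1:]"
    and ?Q = "Polynomial.monom 1 q - smult (s ^ (q - 1)) (Polynomial.monom 1 1)"
  have deg: "Polynomial.degree ?P = q"
    by (simp add: degree_prod_eq_sum_degree card_base)
  have "Polynomial.lead_coeff ?P = 1"
    by (simp add: lead_coeff_prod)
  \<comment> \<open>Because \<open>q > 1\<close>, the linear term of \<open>?Q\<close> does not
    affect its coefficient of degree \<open>q\<close>.\<close>
  with deg have "poly.coeff ?P q = poly.coeff ?Q q"
    using q_gt_1 by simp
  moreover have "card (range (\<lambda>c. \<iota> c * s)) = q"
    unfolding card_base[symmetric] by (rule card_image) (use False in \<open>auto simp: inj_on_def hom_eq_iff\<close>)
  moreover have "Polynomial.degree ?Q \<le> q"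
    using q_gt_1
    by (intro degree_diff_le)
      (auto intro: degree_monom_le le_trans[OF degree_smult_le] le_trans[OF degree_monom_le])
  moreover have "poly ?P z = poly ?Q z" if "z \<in> range (\<lambda>c. \<iota> c * s)" for z
  proof -
    from that obtain c where z: "z = \<iota> c * s" by blast
    have "poly ?P z = 0"
      unfolding z poly_prod by (rule prod_zero) auto
    moreover have "s ^ q = s ^ (q - 1) * s"
      by (metis power_minus_mult q_gt_0)
    then have "poly ?Q z = 0"
      using hom_power_card[of c 1] by (simp add: z poly_monom power_mult_distrib)
    ultimately show ?thesis by simp
  qed
  ultimately show ?thesis
    using deg by (intro poly_eqI_degree_lead_coeff[where n = q and A = "range (\<lambda>c. \<iota> c * s)"]) auto
qed

text \<open>This is the previous factorization with \<open>P\<close> substituted for X. If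
  \<open>P\<close> is linearized and \<open>s\<close> is its value at a new generator, the factors
  are the translates of \<open>P\<close> by the multiples of that generator.\<close>

lemma prod_translates:
  "(\<Prod>c\<in>UNIV. P - [:\<iota> c * s:]) = P ^ q - smult (s ^ (q - 1)) P"
proof -
  have *: "[:- a, 1:] \<circ>\<^sub>p P = P - [:a:]" for a
    by (simp add: pcompose_pCons)
  have "(\<Prod>c\<in>UNIV. P - [:\<iota> c * s:]) = (\<Prod>c\<in>UNIV. [:- (\<iota> c * s), 1:]) \<circ>\<^sub>p P"
    by (simp add: pcompose_prod *)
  then show ?thesis
    by (simp only: prod_linear_factors pcompose_diff pcompose_smult pcompose_monom
        power_one_right smult_1_left)
qed

text \<open>\<open>X ^ q - X\<close> is invariant under \<open>X \<mapsto> X + 1\<close>, being the product of all \<open>X - \<iota> c\<close>;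
  this avoids writing \<open>q\<close> as a power of the characteristic.\<close>

lemma binomial_card_eq_0:
  assumes "0 < k" "k < q"
  shows "of_nat (q choose k) = (0 :: 'l)"
proof -
  let ?X = "[:0, 1:] :: 'l poly"
  have P: "(\<Prod>c\<in>UNIV. P - [:\<iota> c:]) = P ^ q - P" for P
    using prod_translates[of P 1] by simp
  have "[:1, 1:] ^ q - [:1, 1:] = (\<Prod>c\<in>UNIV. [:1, 1:] - [:\<iota> c:])"
    by (simp only: P)
  also have "\<dots> = (\<Prod>c\<in>UNIV. ?X - [:\<iota> c:])"
    by (rule prod.reindex_bij_witness[of _ "\<lambda>c. c + 1" "\<lambda>c. c - 1"])
      (simp_all add: hom_diff hom_one)
  also have "\<dots> = Polynomial.monom 1 q - ?X"
    by (simp only: P monom_altdef smult_1_left)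
  finally have "[:1, 1:] ^ q = Polynomial.monom 1 q + ([:1, 1:] - ?X)"
    by (simp only: algebra_simps)
  \<comment> \<open>The right-hand side has terms only in degrees 0 and \<open>q\<close>, while the
    coefficient on the left is the binomial one.\<close>
  then have "poly.coeff ([:1, 1:] ^ q) k = poly.coeff (Polynomial.monom 1 q + [:1 :: 'l:]) k"
    by simp
  then show ?thesis
    using assms by (simp add: coeff_linear_poly_power coeff_pCons split: nat.splits)
qed

lemma power_q_add: "(P + Q) ^ q = P ^ q + Q ^ q" for P Q :: "'l poly"
  by (rule binomial_power_add) (simp_all add: binomial_card_eq_0 of_nat_poly)

lemma power_q_power_add: "(P + Q) ^ (q ^ i) = P ^ (q ^ i) + Q ^ (q ^ i)" for P Q :: "'l poly"
proof (induction i)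
  case (Suc i)
  then show ?case
    by (simp add: mult.commute[of q] power_mult power_q_add)
qed simp

lemma power_q_sum: "(\<Sum>i\<in>I. P i) ^ q = (\<Sum>i\<in>I. P i ^ q)" for P :: "'i \<Rightarrow> 'l poly"
  by (induction I rule: infinite_finite_induct) (simp_all add: power_q_add power_0_left)

section \<open>Additivity and translation of linearized polynomials\<close>

abbreviation linearized :: "'l poly \<Rightarrow> bool" where
  "linearized \<equiv> linearized_poly q UNIV"

text \<open>Frobenius powers are additive on polynomials, not only on field elements. This stronger
  form gives both the additivity of values and \<open>linearized_shift\<close>.\<close>

lemma linearized_pcompose_add:
  assumes "linearized L"
  shows "L \<circ>\<^sub>p (P + Q) = L \<circ>\<^sub>p P + L \<circ>\<^sub>p Q"
proof -
  from assms obtain d \<alpha> where "L = (\<Sum>i\<le>d. Polynomial.monom (\<alpha> i) (q ^ i))"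
    unfolding linearized_poly_def by blast
  then show ?thesis
    by (simp add: pcompose_sum pcompose_monom power_q_power_add smult_add_right sum.distrib)
qed

lemma linearized_poly_add:
  assumes "linearized L"
  shows "poly L (x + y) = poly L x + poly L y"
  using linearized_pcompose_add[OF assms, of "[:x:]" "[:y:]"] by (simp add: pcompose_pCons_0)

lemma linearized_poly_0:
  assumes "linearized L"
  shows "poly L 0 = 0"
  using linearized_poly_add[OF assms, of 0 0] by (simp only: add_0_right add_cancel_right_right)

lemma linearized_poly_uminus:
  assumes "linearized L"
  shows "poly L (- x) = - poly L x"
  using linearized_poly_add[OF assms, of x "- x"] linearized_poly_0[OF assms]
  by (simp add: eq_neg_iff_add_eq_0 add.commute)

lemma linearized_poly_scale:
  assumes "linearized L"
  shows "poly L (\<iota> c * x) = \<iota> c * poly L x"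
proof -
  from assms obtain d \<alpha> where "L = (\<Sum>i\<le>d. Polynomial.monom (\<alpha> i) (q ^ i))"
    unfolding linearized_poly_def by blast
  then show ?thesis
    by (simp add: poly_sum poly_monom power_mult_distrib hom_power_card sum_distrib_left
        mult.left_commute)
qed

text \<open>Additivity splits off the constant \<open>poly L (- a)\<close>. Hence translation by a
  root fixes \<open>L\<close>, and translation by any other element alters only its constant
  term.\<close>

lemma linearized_shift:
  assumes "linearized L"
  shows "L \<circ>\<^sub>p [:- a, 1:] = L - [:poly L a:]"
proof -
  have "[:- a, 1:] = [:0, 1:] + [:- a:]" by simp
  then have "L \<circ>\<^sub>p [:- a, 1:] = L \<circ>\<^sub>p [:0, 1:] + L \<circ>\<^sub>p [:- a:]"
    by (simp only: linearized_pcompose_add[OF assms])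
  then show ?thesis
    by (simp add: pcompose_pCons_0 linearized_poly_uminus[OF assms] minus_pCons
        flip: diff_conv_add_uminus)
qed

lemma linearized_power_q_diff:
  assumes "linearized L"
  shows "linearized (L ^ q - smult s L)"
proof -
  from assms obtain d \<alpha> where L: "L = (\<Sum>i\<le>d. Polynomial.monom (\<alpha> i) (q ^ i))"
    unfolding linearized_poly_def by blast
  \<comment> \<open>Raising to the power \<open>q\<close> moves coefficient \<open>i\<close> to
    index \<open>i + 1\<close>. The zero defaults at index 0 and beyond \<open>d\<close> bring both
    parts to the common range up to \<open>Suc d\<close>.\<close>
  define \<beta> where "\<beta> i = (if i = 0 then 0 else \<alpha> (i - 1) ^ q) - (if i \<le> d then s * \<alpha> i else 0)" for i
  have "L ^ q = (\<Sum>i\<le>d. Polynomial.monom (\<alpha> i ^ q) (q ^ Suc i))"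
    by (simp add: L power_q_sum monom_power mult.commute)
  also have "\<dots> = (\<Sum>i\<le>Suc d. Polynomial.monom (if i = 0 then 0 else \<alpha> (i - 1) ^ q) (q ^ i))"
    by (simp add: sum.atMost_Suc_shift del: sum.atMost_Suc)
  finally have "L ^ q = \<dots>" .
  moreover have "smult s L = (\<Sum>i\<le>Suc d. Polynomial.monom (if i \<le> d then s * \<alpha> i else 0) (q ^ i))"
    by (rule poly_eqI) (simp add: L coeff_sum sum_distrib_left if_distrib cong: if_cong)
  ultimately have "L ^ q - smult s L = (\<Sum>i\<le>Suc d. Polynomial.monom (\<beta> i) (q ^ i))"
    by (simp only: \<beta>_def diff_monom[symmetric] sum_subtractf)
  then show ?thesis
    unfolding linearized_poly_def by blast
qed

lemma linearized_X: "linearized [:0, 1:]"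
  unfolding linearized_poly_def
  by (intro exI[of _ 0] exI[of _ "\<lambda>_. 1"]) (simp add: monom_altdef)

section \<open>From multispans to linearized polynomials\<close>

lemma linearized_root_poly_mspan_list:
  fixes \<phi> :: "'k ^ 'n \<Rightarrow> 'l"
  assumes add: "\<And>x y. \<phi> (x + y) = \<phi> x + \<phi> y" and scale: "\<And>c x. \<phi> (c *s x) = \<iota> c * \<phi> x"
  shows "linearized (root_poly (image_mset \<phi> (mspan_list bs)))"
proof (induction bs)
  case Nil
  \<comment> \<open>With no generators the only root is 0, so the induction starts from X.\<close>
  have "\<phi> 0 = 0"
    using add[of 0 0] by (simp only: add_0_right add_cancel_right_right)
  then show ?case
    using linearized_X by simp
next
  case (Cons b bs)
  define M where "M = image_mset \<phi> (mspan_list bs)"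
  define L where "L = root_poly M"
  have "image_mset \<phi> (sum N S) = (\<Sum>c\<in>S. image_mset \<phi> (N c))"
    for N :: "'k \<Rightarrow> ('k ^ 'n) multiset" and S
    by (induction S rule: infinite_finite_induct) simp_all
  then have "image_mset \<phi> (mspan_list (b # bs)) = (\<Sum>c\<in>UNIV. image_mset ((+) (\<iota> c * \<phi> b)) M)"
    by (simp add: mspan_list_Cons M_def multiset.map_comp o_def add scale)
  \<comment> \<open>Translating the roots by \<open>\<iota> c * \<phi> b\<close> shifts the argument
    of \<open>L\<close>. As \<open>L\<close> is linearized by induction, this only subtracts its
    value there, and \<open>\<iota> c\<close> factors out of that value.\<close>
  then have "root_poly (image_mset \<phi> (mspan_list (b # bs))) =
      (\<Prod>c\<in>UNIV. L - [:\<iota> c * poly L (\<phi> b):])"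
    using Cons by (simp add: root_poly_sum root_poly_translate linearized_shift linearized_poly_scale
        L_def M_def)
  also have "\<dots> = L ^ q - smult (poly L (\<phi> b) ^ (q - 1)) L"
    by (rule prod_translates)
  finally show ?case
    using Cons by (simp add: L_def M_def linearized_power_q_diff)
qed

section \<open>From linearized polynomials to multispaces\<close>

lemma linearized_order_0:
  assumes "linearized L" "L \<noteq> 0"
  shows "\<exists>e. Polynomial.order 0 L = q ^ e"
proof -
  from assms(1) obtain d \<alpha> where L: "L = (\<Sum>i\<le>d. Polynomial.monom (\<alpha> i) (q ^ i))"
    unfolding linearized_poly_def by blast
  have coeff: "poly.coeff L k = (\<Sum>i\<le>d. if q ^ i = k then \<alpha> i else 0)" for k
    by (simp add: L coeff_sum)
  have "\<exists>i. i \<le> d \<and> \<alpha> i \<noteq> 0"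
    using assms(2) unfolding L by (auto intro: ccontr)
  \<comment> \<open>\<open>e\<close> is the least index with a nonzero coefficient. Since the powers
    of \<open>q\<close> increase strictly, the lowest term of \<open>L\<close> has degree
    \<open>q ^ e\<close>.\<close>
  then obtain e where e: "e \<le> d" "\<alpha> e \<noteq> 0" "\<And>i. i < e \<Longrightarrow> \<alpha> i = 0"
    using exists_least_iff[of "\<lambda>i. i \<le> d \<and> \<alpha> i \<noteq> 0"] by (metis le_trans less_imp_le)
  have inj: "q ^ i = q ^ j \<longleftrightarrow> i = j" "q ^ i < q ^ j \<longleftrightarrow> i < j" for i j
    using q_gt_1 by simp_all
  have "poly.coeff L (q ^ e) = \<alpha> e"
    using e(1) by (simp add: coeff inj)
  moreover have "poly.coeff L k = 0" if "k < q ^ e" for k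
    unfolding coeff using that inj(2) e(3) by (intro sum.neutral) auto
  moreover have "[:- 0, 1:] ^ m = (Polynomial.monom 1 m :: 'l poly)" for m
    by (simp add: monom_altdef)
  ultimately have "Polynomial.order 0 L = q ^ e"
    by (intro order_unique_lemma) (use e(2) in \<open>auto simp only: monom_1_dvd_iff' lessI\<close>)
  then show ?thesis ..
qed

text \<open>\<open>\<phi>\<close> is injective rather than bijective so that the target can be the
  algebraic closure; \<open>roots\<close> forces every root into its image.\<close>

lemma multispace_of_linearized_roots:
  fixes \<phi> :: "'k ^ 'n \<Rightarrow> 'l"
  assumes add: "\<And>x y. \<phi> (x + y) = \<phi> x + \<phi> y" and scale: "\<And>c x. \<phi> (c *s x) = \<iota> c * \<phi> x"
    and "inj \<phi>" and L: "linearized L" "L \<noteq> 0" and roots: "proots L = image_mset \<phi> W"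
  shows "multispace W"
proof -
  let ?V = "{v. poly L (\<phi> v) = 0}"
  obtain e where e: "Polynomial.order 0 L = q ^ e"
    using linearized_order_0[OF L] by blast
  have "\<phi> 0 = 0"
    using add[of 0 0] by (simp only: add_0_right add_cancel_right_right)
  then have "vec.subspace ?V"
    unfolding vec.subspace_def
    by (simp add: add scale linearized_poly_0 linearized_poly_add linearized_poly_scale L(1))
  moreover have "count W v = (if v \<in> ?V then q ^ e else 0)" for v
  proof -
    have "count W v = count (image_mset \<phi> W) (\<phi> v)"
      using \<open>inj \<phi>\<close> by (induction W) (auto simp: inj_eq)
    also have "\<dots> = Polynomial.order (\<phi> v) L"
      using L(2) by (simp flip: roots)
    \<comment> \<open>At a root \<open>\<phi> v\<close> the shifted polynomial is \<open>L\<close>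
      itself, so the order there equals the order at 0.\<close>
    also have "\<dots> = (if v \<in> ?V then q ^ e else 0)"
      using order_shift[OF L(2), of "\<phi> v"] linearized_shift[OF L(1), of "\<phi> v"] e
      by (cases "v \<in> ?V") (simp_all add: order_0I)
    finally show ?thesis .
  qed
  ultimately show ?thesis
    unfolding card_base[symmetric] by (rule multispace_subspace)
qed

end

section \<open>Passage to the algebraic closure and the equivalence\<close>

lemma linearized_poly_map_to_ac:
  assumes "linearized_poly q K L"
  shows "linearized_poly q UNIV (map_poly to_ac L)"
proof -
  from assms obtain d \<alpha> where "L = (\<Sum>i\<le>d. Polynomial.monom (\<alpha> i) (q ^ i))"
    unfolding linearized_poly_def by blast
  then have "map_poly to_ac L = (\<Sum>i\<le>d. Polynomial.monom (to_ac (\<alpha> i)) (q ^ i))"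
    by (intro poly_eqI) (simp add: coeff_map_poly coeff_sum to_ac_sum if_distrib cong: if_cong)
  then show ?thesis
    unfolding linearized_poly_def by (intro exI[of _ d] exI[of _ "\<lambda>i. to_ac (\<alpha> i)"]) simp
qed

theorem proposition2p5:
  fixes q n :: nat
    and \<iota> :: "'k::{field,finite} \<Rightarrow> 'l::{field,finite}"
    and \<phi> :: "'k ^ 'n \<Rightarrow> 'l"
    and W :: "('k ^ 'n) multiset"
  assumes "CARD('k) = q"
    and "CARD('n) = n"
    and "CARD('l) = q ^ n"
    and "\<iota> \<in> ring_hom ring_of_type_algebra ring_of_type_algebra"
    and "Vector_Spaces.linear vector_scalar_mult (\<lambda>c x. \<iota> c * x) \<phi>"
    and "bij \<phi>"
  shows "multispace W \<longleftrightarrow>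
    (\<exists>l K L. l dvd n \<and>
       subfield K (ring_of_type_algebra :: 'l ring) \<and> card K = q ^ l \<and>
       L \<noteq> 0 \<and> linearized_poly q K L \<and>
       all_roots L (image_mset \<phi> W))"
proof -
  have add: "\<phi> (x + y) = \<phi> x + \<phi> y" and scale: "\<phi> (c *s x) = \<iota> c * \<phi> x" for x y c
    using assms(5) by (simp_all add: Vector_Spaces.linear_def module_hom_def module_hom_axioms_def)
  \<comment> \<open>The forward direction builds its polynomial over \<open>'l\<close> itself; the
    converse uses a second instance over the closure, where \<open>all_roots\<close> counts
    roots.\<close>
  interpret base: finite_field_embedding q \<iota>
    using ring_hom_mult[OF assms(4)] ring_hom_add[OF assms(4)] ring_hom_one[OF assms(4)]
    by unfold_locales (simp_all add: assms(1) ring_of_type_algebra_def)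
  interpret closure: finite_field_embedding q "\<lambda>c. to_ac (\<iota> c)"
    by unfold_locales (simp_all add: assms(1) base.hom_add base.hom_mult base.hom_one)
  show ?thesis
  proof
    assume "multispace W"
    then obtain B where "W = mspan B"
      by (auto simp: multispace_def)
    moreover obtain bs where "mset bs = B"
      using ex_mset by blast
    ultimately have W: "W = mspan_list bs"
      using mspan_mset by blast
    \<comment> \<open>The witnesses are \<open>l = n\<close>, the whole field for \<open>K\<close>,
      and this product of linear factors.\<close>
    let ?L = "root_poly (image_mset \<phi> W)"
    interpret L: Ring.field "ring_of_type_algebra :: 'l ring" ..
    have "subfield UNIV (ring_of_type_algebra :: 'l ring)"
      using L.carrier_is_subfield by (simp add: ring_of_type_algebra_def)
    moreover have "linearized_poly q UNIV ?L"
      using base.linearized_root_poly_mspan_list[OF add scale] by (simp add: W)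
    ultimately show "\<exists>l K L. l dvd n \<and> subfield K (ring_of_type_algebra :: 'l ring) \<and>
        card K = q ^ l \<and> L \<noteq> 0 \<and> linearized_poly q K L \<and> all_roots L (image_mset \<phi> W)"
      using assms(3) all_roots_root_poly root_poly_nonzero dvd_refl by blast
  next
    assume "\<exists>l K L. l dvd n \<and> subfield K (ring_of_type_algebra :: 'l ring) \<and>
        card K = q ^ l \<and> L \<noteq> 0 \<and> linearized_poly q K L \<and> all_roots L (image_mset \<phi> W)"
    then obtain K L where L: "L \<noteq> 0" "linearized_poly q K L" "all_roots L (image_mset \<phi> W)"
      by blast
    show "multispace W"
    proof (rule closure.multispace_of_linearized_roots)
      show "inj (\<lambda>v. to_ac (\<phi> v))"
        using assms(6) by (simp add: inj_def bij_def)
      show "linearized_poly q UNIV (map_poly to_ac L)"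
        by (rule linearized_poly_map_to_ac[OF L(2)])
      show "map_poly to_ac L \<noteq> 0"
        using L(1) by (simp add: map_poly_eq_0_iff)
      \<comment> \<open>\<open>all_roots\<close> already speaks about \<open>proots\<close> over the
        closure; only the two maps \<open>to_ac\<close> and \<open>\<phi>\<close> have to be
        composed.\<close>
      show "proots (map_poly to_ac L) = image_mset (\<lambda>v. to_ac (\<phi> v)) W"
        using L(3) by (simp add: all_roots_def multiset.map_comp o_def)
    qed (simp_all add: add scale)
  qed
qed

end
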